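(* Let $I$ be an ideal on an uncountable Polish space $X$ such that no nonempty open subset of $X$ belongs to $I$, and let $\{U_n:n\in\omega\}$ be a base of open sets of $X$. For $f:X\to X$ let $H_n(f)=\{y\in X: U_n\cap f^{-1}[\{y\}]\notin I\}$. Then: (1) For $x\in X$, $I$ has property (M$'_x$) iff there is a Borel function $f:X\to X$ such that for every $n$ with $x\in U_n$ the set $H_n(f)$ contains a nonempty perfect set. (2) $I$ has property (M$'$) iff there is a Borel $f:X\to X$ such that every $H_n(f)$, $n\in\omega$, contains a nonempty perfect set. (3) $I$ has property (M$^*$) iff there is a Borel $f:X\to X$ such that $\bigcap_{n\in\omega}H_n(f)$ contains a nonempty perfect set. (4) If $I$ is a $\sigma$-ideal and $f:X\to X$ is a Borel function with $f^{-1}[\{x\}]\notin I$ for all $x\in X$ such that each $H_n(f)$ is either countable or contains a nonempty perfect set, then $I$ has property (M$'_x$) for some $x\in X$.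
   Context: Ideals contain all singletons and not the whole space. For $E\subseteq X$, $I$ has (M) rel $E$ if there is a Borel function $g:E\to X$ with $g^{-1}[\{y\}]\notin I$ for every $y\in X$. $I$ has (M$'$) if it has (M) rel $U$ for every nonempty open $U\subseteq X$. For $x\in X$, $I$ has (M$'_x$) if it has (M) rel $U$ for every open neighborhood $U$ of $x$. $I$ has (M$^*$) if there is a Borel $g:X\to X$ such that $g^{-1}[\{y\}]\cap U\notin I$ for every $y\in X$ and every nonempty open $U\subseteq X$. *)

theory Defs
  imports "HOL-Analysis.Analysis"
begin

definition ideal_on :: "'a set set \<Rightarrow> bool" where
  "ideal_on I \<longleftrightarrow> (\<forall>A\<in>I. \<forall>B. B \<subseteq> A \<longrightarrow> B \<in> I)
     \<and> (\<forall>A\<in>I. \<forall>B\<in>I. A \<union> B \<in> I)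
     \<and> (\<forall>x. {x} \<in> I) \<and> UNIV \<notin> I"

definition sigma_ideal_on :: "'a set set \<Rightarrow> bool" where
  "sigma_ideal_on I \<longleftrightarrow> ideal_on I \<and> (\<forall>A::nat \<Rightarrow> 'a set. (\<forall>n. A n \<in> I) \<longrightarrow> (\<Union>n. A n) \<in> I)"

definition borel_on :: "'a::topological_space set \<Rightarrow> ('a \<Rightarrow> 'b::topological_space) \<Rightarrow> bool" where
  "borel_on E g \<longleftrightarrow> (\<forall>V. open V \<longrightarrow> (\<exists>B\<in>sets borel. g -` V \<inter> E = B \<inter> E))"

definition has_M_rel :: "'a::topological_space set set \<Rightarrow> 'a set \<Rightarrow> bool" where
  "has_M_rel I E \<longleftrightarrow> (\<exists>g::'a \<Rightarrow> 'a. borel_on E g \<and> (\<forall>y. g -` {y} \<inter> E \<notin> I))"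

definition has_M' :: "'a::topological_space set set \<Rightarrow> bool" where
  "has_M' I \<longleftrightarrow> (\<forall>U. open U \<and> U \<noteq> {} \<longrightarrow> has_M_rel I U)"

definition has_M'_at :: "'a::topological_space set set \<Rightarrow> 'a \<Rightarrow> bool" where
  "has_M'_at I x \<longleftrightarrow> (\<forall>U. open U \<and> x \<in> U \<longrightarrow> has_M_rel I U)"

definition has_Mstar :: "'a::topological_space set set \<Rightarrow> bool" where
  "has_Mstar I \<longleftrightarrow> (\<exists>g::'a \<Rightarrow> 'a. g \<in> borel_measurable borel \<and>
     (\<forall>y U. open U \<and> U \<noteq> {} \<longrightarrow> g -` {y} \<inter> U \<notin> I))"

definition perfect_set :: "'a::topological_space set \<Rightarrow> bool" where
  "perfect_set P \<longleftrightarrow> closed P \<and> (\<forall>x\<in>P. x islimpt P)"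

definition H_set :: "(nat \<Rightarrow> 'a set) \<Rightarrow> 'a set set \<Rightarrow> nat \<Rightarrow> ('a \<Rightarrow> 'a) \<Rightarrow> 'a set" where
  "H_set U I n f = {y. U n \<inter> f -` {y} \<notin> I}"

definition contains_perfect :: "'a::topological_space set \<Rightarrow> bool" where
  "contains_perfect S \<longleftrightarrow> (\<exists>P. P \<noteq> {} \<and> perfect_set P \<and> P \<subseteq> S)"

end

theory Submission
  imports Defs
begin

text \<open>Containing a perfect set is replaced by a property that Borel maps handle more easily: a set is
  large if some countable family of Borel digit functions realises every sequence of digits on it.
  Nonempty perfect sets are large, and a large set \<open>S\<close> admits a Borel map onto the whole space all of
  whose fibres meet \<open>S\<close> in a large set, because the digits with even index stay free once those
  with odd index are used to code a point.

  Call a set big if (M) holds rel it. By composing with such maps one sees that perfectly many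
  fibres outside \<open>I\<close> suffice for bigness, that the sets that are not big are closed under finite
  unions, and that every big set is partitioned by a Borel map into uncountably many big pieces.
  Given countably many big sets, each of them remains big after the removal of all but at most one
  of such pieces, so some piece can be removed without harm to any. Iterating this produces a
  disjoint refinement by big sets, and gluing the witnesses along it gives the single function
  required in (1) and (2).\<close>

section \<open>Large sets, and perfect sets as examples\<close>

definition large :: "'a::topological_space set \<Rightarrow> bool" where
  "large S \<longleftrightarrow> (\<exists>b :: nat \<Rightarrow> 'a \<Rightarrow> nat. (\<forall>n. b n \<in> measurable borel (count_space UNIV)) \<and>
     (\<forall>t. \<exists>x\<in>S. \<forall>n. b n x = t n))"

lemma dist_geometric_tail:
  fixes z :: "nat \<Rightarrow> 'a::metric_space"
  assumes "\<And>n. dist (z n) (z (Suc n)) \<le> (1/2)^n" and "m \<le> n"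
  shows "dist (z m) (z n) \<le> 2 * (1/2)^m"
proof -
  \<comment> \<open>The bound is the exact geometric sum; the subtracted term is what lets the
    induction close.\<close>
  have "dist (z m) (z (m + k)) \<le> 2 * (1/2)^m - 2 * (1/2)^(m + k)" for k
  proof (induction k)
    case (Suc k)
    have "dist (z m) (z (m + Suc k)) \<le> dist (z m) (z (m + k)) + dist (z (m + k)) (z (Suc (m + k)))"
      using dist_triangle by simp
    with Suc assms(1)[of "m + k"] show ?case by simp
  qed simp
  from this[of "n - m"] assms(2) show ?thesis
    by (smt (verit) le_add_diff_inverse zero_le_power zero_le_divide_1_iff)
qed

lemma convergent_geometric:
  fixes z :: "nat \<Rightarrow> 'a::complete_space"
  assumes "\<And>n. dist (z n) (z (Suc n)) \<le> (1/2)^n"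
  shows "convergent z"
proof -
  have "Cauchy z"
  proof (rule metric_CauchyI)
    fix e :: real assume "e > 0"
    then obtain M where M: "(1/2)^M < e/4"
      using real_arch_pow_inv[of "e/4" "1/2"] by auto
    have "dist (z m) (z n) < e" if "m \<ge> M" "n \<ge> M" for m n
      using dist_geometric_tail[of z, OF assms that(1)] dist_geometric_tail[of z, OF assms that(2)] M
        dist_triangle3[of "z m" "z n" "z M"] by simp
    then show "\<exists>M. \<forall>m\<ge>M. \<forall>n\<ge>M. dist (z m) (z n) < e" by blast
  qed
  then show ?thesis by (rule Cauchy_convergent)
qed

text \<open>A natural digit is coded in unary: digit \<open>n\<close> is the position of the first
  true bit in row \<open>n\<close> of a two-dimensional array of bits. The sequence \<open>t\<close>
  is realised by making bit \<open>t n\<close> the only true one in row \<open>n\<close>.\<close>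

lemma large_if_bool_digits:
  fixes b :: "nat \<Rightarrow> 'a::topological_space \<Rightarrow> bool"
  assumes [measurable]: "\<And>n. Measurable.pred borel (b n)"
    and onto: "\<And>t. \<exists>x\<in>S. \<forall>n. b n x = t n"
  shows "large S"
  unfolding large_def
proof (intro exI[where x = "\<lambda>n x. LEAST k. b (prod_encode (n, k)) x"] conjI allI)
  show "(\<lambda>x. LEAST k. b (prod_encode (n, k)) x) \<in> measurable borel (count_space UNIV)" for n
    by measurable
next
  fix t :: "nat \<Rightarrow> nat"
  obtain x where x: "x \<in> S" "\<forall>n. b n x = (case prod_decode n of (i, k) \<Rightarrow> k = t i)"
    using onto[of "\<lambda>n. case prod_decode n of (i, k) \<Rightarrow> k = t i"] by (elim bexE)
  then show "\<exists>x\<in>S. \<forall>n. (LEAST k. b (prod_encode (n, k)) x) = t n"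
    by (intro bexI[of _ x] allI Least_equality) auto
qed

text \<open>One splitting step of a Cantor scheme: the old centre \<open>c\<close> is kept for one
  ball, and a nearby second point of \<open>P\<close> is the centre of the other.\<close>

lemma perfect_split_ball:
  fixes P :: "'a::metric_space set"
  assumes "c \<in> P" "r > 0" "\<And>x. x \<in> P \<Longrightarrow> x islimpt P"
  obtains c' r' where "c' \<in> P" "r' > 0" "r' \<le> r/2" "cball c r' \<subseteq> cball c r" "cball c' r' \<subseteq> cball c r"
    "cball c r' \<inter> cball c' r' = {}"
proof -
  obtain c' where c': "c' \<in> P" "c' \<noteq> c" "dist c' c < r"
    using assms islimpt_approachable by metis
  define d where "d = dist c' c"
  \<comment> \<open>The bound \<open>d/3\<close> separates the two balls, \<open>r - d\<close> keeps
    the ball around \<open>c'\<close> inside the old one, and \<open>r/2\<close> makes radii shrink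
    geometrically.\<close>
  define r' where "r' = min (d/3) (min (r - d) (r/2))"
  have d: "d > 0" "d < r" using c' by (auto simp: d_def)
  have r': "r' > 0" "r' \<le> d/3" "r' \<le> r - d" "r' \<le> r/2" using d assms(2) unfolding r'_def by linarith+
  show thesis
  proof (rule that[OF c'(1) r'(1,4)])
    show "cball c r' \<subseteq> cball c r" using r' assms(2) by (intro subset_cball) auto
    show "cball c' r' \<subseteq> cball c r"
    proof
      fix x assume "x \<in> cball c' r'"
      then show "x \<in> cball c r" using r'(3) dist_triangle[of c x c'] by (simp add: d_def dist_commute)
    qed
    show "cball c r' \<inter> cball c' r' = {}"
    proof -
      have False if "dist c x \<le> r'" "dist c' x \<le> r'" for x
        using that r' d dist_triangle[of c' c x] by (simp add: d_def dist_commute)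
      then show ?thesis by auto
    qed
  qed
qed

text \<open>A Cantor scheme of closed balls centred in \<open>P\<close> is indexed by finite bit
  lists. The digits of a point record its descent through this tree, and the limit of the centres
  along a branch is a point of \<open>P\<close> whose descent is that branch.\<close>

lemma large_perfect:
  fixes P :: "'a::polish_space set"
  assumes "perfect_set P" "P \<noteq> {}"
  shows "large P"
proof -
  have P: "closed P" "\<And>x. x \<in> P \<Longrightarrow> x islimpt P" using assms by (auto simp: perfect_set_def)
  obtain p where p: "p \<in> P" using assms by auto
  have "\<exists>c' r'. c \<in> P \<and> r > 0 \<longrightarrow> c' \<in> P \<and> r' > 0 \<and> r' \<le> r/2 \<and> cball c r' \<subseteq> cball c r \<and> cball c' r' \<subseteq> cball c r
        \<and> cball c r' \<inter> cball c' r' = {}" for c and r :: real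
    using perfect_split_ball[of c P r, OF _ _ P(2)] by metis
  then obtain C R where CR: "\<And>c r. c \<in> P \<Longrightarrow> r > 0 \<Longrightarrow> C c r \<in> P \<and> R c r > 0 \<and> R c r \<le> r/2 \<and>
      cball c (R c r) \<subseteq> cball c r \<and> cball (C c r) (R c r) \<subseteq> cball c r \<and>
      cball c (R c r) \<inter> cball (C c r) (R c r) = {}" by metis
  \<comment> \<open>The newest bit is the head of the list; \<open>False\<close> keeps the centre
    and \<open>True\<close> moves it.\<close>
  define node :: "bool list \<Rightarrow> 'a \<times> real" where
    "node = rec_list (p, 1) (\<lambda>i _ (c, r). (if i then C c r else c, R c r))"
  define ball_of where "ball_of s = cball (fst (node s)) (snd (node s))" for s
  have node_Nil: "node [] = (p, 1)"
    and node_Cons: "node (i # s) = (let (c, r) = node s in (if i then C c r else c, R c r))" for i s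
    by (auto simp: node_def split: prod.splits)
  have node: "fst (node s) \<in> P \<and> snd (node s) > 0 \<and> snd (node s) \<le> (1/2)^length s" for s
  proof (induction s)
    case (Cons i s)
    then show ?case using CR[of "fst (node s)" "snd (node s)"]
      by (auto simp: node_Cons Let_def split: prod.splits)
  qed (auto simp: node_Nil p)
  have mono: "ball_of (i # s) \<subseteq> ball_of s" and
    disj: "ball_of (False # s) \<inter> ball_of (True # s) = {}" for i s
    using CR[of "fst (node s)" "snd (node s)"] node[of s]
    by (auto simp: ball_of_def node_Cons Let_def split: prod.splits if_splits)
  \<comment> \<open>Digits are needed on the whole space, so a point outside the
    \<open>False\<close> ball goes to \<open>True\<close> even if it is not in the
    \<open>True\<close> ball.\<close>
  define path where "path = rec_nat (\<lambda>_. []) (\<lambda>_ s x. (x \<notin> ball_of (False # s x)) # s x)"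
  have path_0: "path 0 = (\<lambda>_. [])"
    and path_Suc: "path (Suc n) = (\<lambda>x. (x \<notin> ball_of (False # path n x)) # path n x)" for n
    by (auto simp: path_def)
  have [measurable]: "ball_of s \<in> sets borel" for s by (simp add: ball_of_def)
  have path_measurable [measurable]: "path n \<in> measurable borel (count_space UNIV)" for n
  proof (induction n)
    case (Suc n)
    note [measurable] = Suc
    show ?case unfolding path_Suc
      \<comment> \<open>There are only countably many bit lists, so measurability can be checked for
        each fixed list \<open>s\<close>.\<close>
      by (rule measurable_compose_countable[where f = "\<lambda>s x. (x \<notin> ball_of (False # s)) # s"]) measurable
  qed (simp add: path_0)
  define b where "b n x \<longleftrightarrow> x \<notin> ball_of (False # path n x)" for n x
  show ?thesis
  proof (rule large_if_bool_digits)
    show "Measurable.pred borel (b n)" for n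
      unfolding b_def
      by (rule measurable_compose_countable[where f = "\<lambda>s x. x \<notin> ball_of (False # s)"]) measurable
  next
    fix t :: "nat \<Rightarrow> bool"
    define s where "s = rec_nat [] (\<lambda>n u. t n # u)"
    have s: "s 0 = []" "s (Suc n) = t n # s n" for n by (auto simp: s_def)
    have len: "length (s n) = n" for n by (induction n) (auto simp: s)
    define z where "z n = fst (node (s n))" for n
    have sub: "ball_of (s n) \<subseteq> ball_of (s m)" if "m \<le> n" for m n
      using that mono by (induction rule: dec_induct) (auto simp: s)
    have z_in: "z n \<in> ball_of (s m)" if "m \<le> n" for m n
    proof -
      have "z n \<in> ball_of (s n)" using node[of "s n"] by (simp add: z_def ball_of_def)
      with sub[OF that] show ?thesis by blast
    qed
    have "dist (z n) (z (Suc n)) \<le> (1/2)^n" for n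
      using z_in[of n "Suc n"] node[of "s n"] len by (auto simp: ball_of_def z_def)
    from convergent_geometric[of z, OF this] obtain x where x: "z \<longlonglongrightarrow> x"
      by (auto simp: convergent_def)
    have "x \<in> P"
      using closed_sequentially[OF P(1) _ x] node by (simp add: z_def)
    have x_in: "x \<in> ball_of (s m)" for m
    proof (rule Lim_in_closed_set[OF _ _ _ x])
      show "closed (ball_of (s m))" by (simp add: ball_of_def)
      show "eventually (\<lambda>n. z n \<in> ball_of (s m)) sequentially"
        using z_in eventually_sequentially by blast
    qed simp
    have digit: "x \<notin> ball_of (False # s n) \<longleftrightarrow> t n" for n
      using x_in[of "Suc n"] disj[of "s n"] by (cases "t n") (auto simp: s)
    have "path n x = s n" for n
      by (induction n) (auto simp: path_0 path_Suc s digit)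
    with digit have "\<forall>n. b n x = t n" by (simp add: b_def)
    with \<open>x \<in> P\<close> show "\<exists>x\<in>P. \<forall>n. b n x = t n" by (rule bexI[rotated])
  qed
qed

section \<open>Coding points by digits, and Borel maps with large fibres\<close>

lemma nat_digits_onto_polish:
  fixes M :: "'b measure"
  obtains F :: "(nat \<Rightarrow> nat) \<Rightarrow> 'a::polish_space" where "surj F"
    and "\<forall>b. (\<forall>n. b n \<in> measurable M (count_space UNIV)) \<longrightarrow> (\<lambda>x. F (\<lambda>n. b n x)) \<in> borel_measurable M"
proof -
  obtain D :: "'a set" where D: "countable D" "\<And>V. open V \<Longrightarrow> V \<noteq> {} \<Longrightarrow> \<exists>d\<in>D. d \<in> V"
    by (rule countable_dense_setE) blast
  define d where "d = from_nat_into D"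
  have dense: "\<exists>n. dist (d n) y < e" if "e > 0" for y e
  proof -
    have "y \<in> ball y e" using that by simp
    then obtain v where "v \<in> D" "v \<in> ball y e" using D(2)[of "ball y e"] open_ball by blast
    then show ?thesis using from_nat_into_surj[OF D(1), of v] by (auto simp: d_def dist_commute)
  qed
  \<comment> \<open>The sequence jumps to the next point named by \<open>t\<close> only if the jump
    is shorter than \<open>(1/2)^n\<close>, and stays put otherwise. It thus converges for every
    \<open>t\<close>, and each term depends measurably on the digits.\<close>
  define z where "z t = rec_nat (d (t 0)) (\<lambda>n u. if dist u (d (t (Suc n))) < (1/2)^n then d (t (Suc n)) else u)"
    for t :: "nat \<Rightarrow> nat"
  have z: "z t 0 = d (t 0)"
    "z t (Suc n) = (if dist (z t n) (d (t (Suc n))) < (1/2)^n then d (t (Suc n)) else z t n)" for t n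
    by (auto simp: z_def)
  have conv: "z t \<longlonglongrightarrow> lim (z t)" for t
    using convergent_geometric[of "z t"] by (simp add: z convergent_LIMSEQ_iff)
  show thesis
  proof (rule that[of "\<lambda>t. lim (z t)"])
    have "\<exists>t. lim (z t) = y" for y
    proof -
      \<comment> \<open>With these errors consecutive points are less than \<open>(1/2)^n\<close>
        apart, so no jump is refused.\<close>
      obtain t where t: "\<And>n. dist (d (t n)) y < (1/2)^n / 4"
        using choice[of "\<lambda>n k. dist (d k) y < (1/2)^n / 4"] dense by (auto simp: power_divide)
      have zt: "z t n = d (t n)" for n
      proof (induction n)
        case (Suc n)
        have "dist (d (t n)) (d (t (Suc n))) < (1/2)^n"
          using t[of n] t[of "Suc n"] dist_triangle2[of "d (t n)" "d (t (Suc n))" y]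
            zero_less_power[of "1/2::real" n] unfolding power_Suc by linarith
        with Suc show ?case by (simp add: z)
      qed (simp add: z)
      have "(\<lambda>n. dist (z t n) y) \<longlonglongrightarrow> 0"
      proof (rule tendsto_sandwich[where f = "\<lambda>_. 0" and h = "\<lambda>n. (1/2)^n / 4"])
        show "(\<lambda>n. (1/2)^n / 4 :: real) \<longlonglongrightarrow> 0"
          by (intro tendsto_divide_zero LIMSEQ_realpow_zero) auto
        show "eventually (\<lambda>n. dist (z t n) y \<le> (1/2)^n / 4) sequentially"
          unfolding zt by (intro always_eventually allI less_imp_le t)
      qed auto
      then have "z t \<longlonglongrightarrow> y" by (rule tendsto_dist_iff[THEN iffD2])
      then have "lim (z t) = y" by (rule limI)
      then show ?thesis by blast
    qed
    then show "surj (\<lambda>t. lim (z t))" by (metis surjI)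
  next
    show "\<forall>b. (\<forall>n. b n \<in> measurable M (count_space UNIV)) \<longrightarrow> (\<lambda>x. lim (z (\<lambda>n. b n x))) \<in> borel_measurable M"
    proof (intro allI impI)
      fix b :: "nat \<Rightarrow> 'b \<Rightarrow> nat"
      assume b: "\<forall>n. b n \<in> measurable M (count_space UNIV)"
      then have [measurable]: "b n \<in> measurable M (count_space UNIV)" for n by blast
      have [measurable]: "(\<lambda>x. d (b n x)) \<in> borel_measurable M" for n
        by measurable
      have "(\<lambda>x. z (\<lambda>n. b n x) n) \<in> borel_measurable M" for n
      proof (induction n)
        case (Suc n)
        note [measurable] = Suc
        show ?case unfolding z by measurable
      qed (simp add: z)
      then show "(\<lambda>x. lim (z (\<lambda>n. b n x))) \<in> borel_measurable M"
        by (rule borel_measurable_LIMSEQ_metric) (rule conv)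
    qed
  qed
qed

lemma large_fibres:
  fixes S :: "'a::topological_space set"
  assumes "large S"
  obtains h :: "'a \<Rightarrow> 'b::polish_space" where "h \<in> borel_measurable borel"
    and "\<And>y. large (h -` {y} \<inter> S)"
proof -
  obtain b :: "nat \<Rightarrow> 'a \<Rightarrow> nat" where b [measurable]: "\<And>n. b n \<in> measurable borel (count_space UNIV)"
    and onto: "\<And>t. \<exists>x\<in>S. \<forall>n. b n x = t n"
    using assms unfolding large_def by blast
  obtain F :: "(nat \<Rightarrow> nat) \<Rightarrow> 'b" where F: "surj F"
    "\<forall>b. (\<forall>n. b n \<in> measurable borel (count_space UNIV)) \<longrightarrow>
      (\<lambda>x :: 'a. F (\<lambda>n. b n x)) \<in> borel_measurable borel"
    by (rule nat_digits_onto_polish)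
  show thesis
  proof (rule that)
    show "(\<lambda>x. F (\<lambda>n. b (2 * n + 1) x)) \<in> borel_measurable borel"
      by (intro F(2)[rule_format]) measurable
    fix y
    \<comment> \<open>Setting the odd digits to the code \<open>u\<close> puts a point into the
      fibre over \<open>y\<close>; the even digits remain free and show that this fibre is large in
      \<open>S\<close>.\<close>
    obtain u where u: "F u = y" using F(1) by (metis surjD)
    have "\<exists>x\<in>(\<lambda>x. F (\<lambda>n. b (2 * n + 1) x)) -` {y} \<inter> S. \<forall>n. b (2 * n) x = t n" for t
    proof -
      obtain x where "x \<in> S" "\<forall>n. b n x = (if even n then t (n div 2) else u (n div 2))"
        using onto[of "\<lambda>n. if even n then t (n div 2) else u (n div 2)"] by (elim bexE)
      with u show ?thesis by (intro bexI[of _ x]) auto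
    qed
    then show "large ((\<lambda>x. F (\<lambda>n. b (2 * n + 1) x)) -` {y} \<inter> S)"
      unfolding large_def by (intro exI[of _ "\<lambda>n. b (2 * n)"]) auto
  qed
qed

section \<open>Big sets: composition, finite unions and partitions\<close>

definition big :: "'a::topological_space set set \<Rightarrow> 'a set \<Rightarrow> bool" where
  "big I E \<longleftrightarrow> (\<exists>g :: 'a \<Rightarrow> 'a. g \<in> borel_measurable borel \<and> (\<forall>y. g -` {y} \<inter> E \<notin> I))"

lemma borel_on_if_measurable:
  fixes g :: "'a::topological_space \<Rightarrow> 'b::topological_space"
  assumes "g \<in> borel_measurable borel"
  shows "borel_on E g"
  unfolding borel_on_def
proof (intro allI impI)
  fix V :: "'b set" assume "open V"
  then have "g -` V \<in> sets borel" using measurable_sets[OF assms, of V] by simp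
  then show "\<exists>B\<in>sets borel. g -` V \<inter> E = B \<inter> E" by blast
qed

text \<open>A relative witness on a Borel set extends by a constant to a Borel map on the whole
  space with the same fibres in \<open>E\<close>. Such total maps can be composed and glued
  freely.\<close>

lemma has_M_rel_iff_big:
  fixes E :: "'a::topological_space set"
  assumes "E \<in> sets borel"
  shows "has_M_rel I E \<longleftrightarrow> big I E"
proof
  assume "has_M_rel I E"
  then obtain g :: "'a \<Rightarrow> 'a" where g: "borel_on E g" "\<And>y. g -` {y} \<inter> E \<notin> I"
    by (auto simp: has_M_rel_def)
  define g' where "g' x = (if x \<in> E then g x else undefined)" for x
  have "g' \<in> borel_measurable borel"
  proof (rule borel_measurableI)
    fix V :: "'a set" assume "open V"
    then obtain B where B: "B \<in> sets borel" "g -` V \<inter> E = B \<inter> E"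
      using g(1) by (auto simp: borel_on_def)
    have "g' -` V = (B \<inter> E) \<union> (if undefined \<in> V then - E else {})"
      unfolding B(2)[symmetric] by (auto simp: g'_def split: if_splits)
    then show "g' -` V \<inter> space borel \<in> sets borel"
      using B(1) assms by auto
  qed
  moreover have "g' -` {y} \<inter> E = g -` {y} \<inter> E" for y
    by (auto simp: g'_def)
  ultimately show "big I E" using g(2) by (auto simp: big_def)
next
  assume "big I E"
  then show "has_M_rel I E" by (auto simp: big_def has_M_rel_def intro: borel_on_if_measurable)
qed

lemma ideal_on_subset: "ideal_on I \<Longrightarrow> A \<in> I \<Longrightarrow> B \<subseteq> A \<Longrightarrow> B \<in> I"
  by (auto simp: ideal_on_def)

lemma ideal_on_Un: "ideal_on I \<Longrightarrow> A \<in> I \<Longrightarrow> B \<in> I \<Longrightarrow> A \<union> B \<in> I"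
  by (auto simp: ideal_on_def)

text \<open>Compose \<open>g\<close> with a Borel map \<open>h\<close> that sends \<open>S\<close>
  onto the whole space: each fibre of \<open>h \<circ> g\<close> contains a fibre of
  \<open>g\<close> over a point of \<open>S\<close>.\<close>

lemma big_if_large:
  fixes I :: "'a::polish_space set set" and g :: "'a \<Rightarrow> 'a"
  assumes "ideal_on I" and [measurable]: "g \<in> borel_measurable borel"
    and "large S" "\<And>y. y \<in> S \<Longrightarrow> g -` {y} \<inter> E \<notin> I"
  shows "big I E"
proof -
  obtain h :: "'a \<Rightarrow> 'a" where h [measurable]: "h \<in> borel_measurable borel"
    and hS: "\<And>y. large (h -` {y} \<inter> S)"
    using large_fibres[OF assms(3)] by metis
  have "(h \<circ> g) -` {y} \<inter> E \<notin> I" for y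
  proof
    assume fibre: "(h \<circ> g) -` {y} \<inter> E \<in> I"
    obtain z where z: "z \<in> S" "h z = y" using hS[of y] unfolding large_def by blast
    then have "g -` {z} \<inter> E \<subseteq> (h \<circ> g) -` {y} \<inter> E" by auto
    with fibre z assms(1,4) show False using ideal_on_subset by metis
  qed
  moreover have "h \<circ> g \<in> borel_measurable borel" by measurable
  ultimately show ?thesis unfolding big_def by blast
qed

lemma big_Un:
  fixes I :: "'a::polish_space set set"
  assumes "ideal_on I" "large (UNIV :: 'a set)" "big I (A \<union> B)"
  shows "big I A \<or> big I B"
proof (rule disjCI)
  assume "\<not> big I B"
  obtain g :: "'a \<Rightarrow> 'a" where g [measurable]: "g \<in> borel_measurable borel" and gI: "\<And>y. g -` {y} \<inter> (A \<union> B) \<notin> I"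
    using assms(3) by (auto simp: big_def)
  obtain h :: "'a \<Rightarrow> 'a" where h [measurable]: "h \<in> borel_measurable borel"
    and hS: "\<And>y. large (h -` {y} \<inter> UNIV)"
    using large_fibres[OF assms(2)] by metis
  have "(h \<circ> g) -` {y} \<inter> A \<notin> I" for y
  proof
    assume fibre: "(h \<circ> g) -` {y} \<inter> A \<in> I"
    have "g -` {z} \<inter> B \<notin> I" if "z \<in> h -` {y}" for z
    proof
      assume "g -` {z} \<inter> B \<in> I"
      moreover have "g -` {z} \<inter> A \<in> I" using fibre that by (auto intro: ideal_on_subset[OF assms(1)])
      ultimately show False using gI[of z] ideal_on_Un[OF assms(1)] by (metis Int_Un_distrib)
    qed
    with big_if_large[OF assms(1) g, of "h -` {y}" B] hS[of y] \<open>\<not> big I B\<close> show False by simp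
  qed
  moreover have "h \<circ> g \<in> borel_measurable borel" by measurable
  ultimately show "big I A" unfolding big_def by blast
qed

lemma big_partition:
  fixes I :: "'a::polish_space set set"
  assumes "ideal_on I" "large (UNIV :: 'a set)" "big I E"
  obtains k :: "'a \<Rightarrow> 'a" where "k \<in> borel_measurable borel" "\<And>y. big I (E \<inter> k -` {y})"
proof -
  obtain g :: "'a \<Rightarrow> 'a" where g [measurable]: "g \<in> borel_measurable borel" and gI: "\<And>y. g -` {y} \<inter> E \<notin> I"
    using assms(3) by (auto simp: big_def)
  obtain h :: "'a \<Rightarrow> 'a" where h [measurable]: "h \<in> borel_measurable borel"
    and hS: "\<And>y. large (h -` {y} \<inter> UNIV)"
    using large_fibres[OF assms(2)] by metis
  show thesis
  proof (rule that[of "h \<circ> g"])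
    show "h \<circ> g \<in> borel_measurable borel" by measurable
    fix y
    have "g -` {z} \<inter> (E \<inter> (h \<circ> g) -` {y}) = g -` {z} \<inter> E" if "z \<in> h -` {y}" for z
      using that by auto
    with gI big_if_large[OF assms(1) g, of "h -` {y}" "E \<inter> (h \<circ> g) -` {y}"] hS[of y]
    show "big I (E \<inter> (h \<circ> g) -` {y})" by simp
  qed
qed

section \<open>Disjoint refinement and a common witness\<close>

lemma big_remove_piece:
  fixes I :: "'a::polish_space set set" and E :: "nat \<Rightarrow> 'a set"
  assumes "ideal_on I" "uncountable (UNIV :: 'a set)" "large (UNIV :: 'a set)"
    and bigE: "\<And>n. big I (E n)"
  obtains D where "D \<in> sets borel" "big I (E m \<inter> D)" "\<And>n. big I (E n - D)"
proof -
  obtain k :: "'a \<Rightarrow> 'a" where k: "k \<in> borel_measurable borel" "\<And>y. big I (E m \<inter> k -` {y})"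
    using big_partition[OF assms(1,3) bigE[of m]] by metis
  define bad where "bad n = {y. \<not> big I (E n - k -` {y})}" for n
  \<comment> \<open>Distinct pieces are disjoint, so two bad values would split \<open>E n\<close>
    into a union of two sets that are not big. Hence only countably many values are bad for some
    \<open>n\<close>.\<close>
  have "y = y'" if "y \<in> bad n" "y' \<in> bad n" for n y y'
  proof (rule ccontr)
    assume "y \<noteq> y'"
    then have "E n = (E n - k -` {y}) \<union> (E n - k -` {y'})" by auto
    with bigE[of n] have "big I (E n - k -` {y}) \<or> big I (E n - k -` {y'})"
      using big_Un[OF assms(1,3)] by metis
    with that show False by (simp add: bad_def)
  qed
  then have "\<exists>y. bad n \<subseteq> {y}" for n by blast
  then have "countable (\<Union>n. bad n)"
    by (meson countable_UN countable_empty countable_insert countable_subset countableI_type)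
  then obtain y where "y \<notin> (\<Union>n. bad n)"
    using assms(2) by (metis UNIV_eq_I)
  moreover have "k -` {y} \<in> sets borel"
    using measurable_sets[OF k(1), of "{y}"] by simp
  ultimately show thesis using k(2) by (intro that[of "k -` {y}"]) (auto simp: bad_def)
qed

text \<open>\<open>R m\<close> is the part of the space used up before stage \<open>m\<close>, and
  the invariant keeps what is left of every \<open>E n\<close> big. Stage \<open>m\<close> reserves
  a big piece of \<open>E m\<close> in \<open>R (Suc m) - R m\<close>, where the glued map follows
  the witness \<open>g m\<close>.\<close>

lemma big_common_witness:
  fixes I :: "'a::polish_space set set" and E :: "nat \<Rightarrow> 'a set"
  assumes "ideal_on I" "uncountable (UNIV :: 'a set)" "large (UNIV :: 'a set)"
    and bigE: "\<And>n. big I (E n)"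
  obtains f :: "'a \<Rightarrow> 'a" where "f \<in> borel_measurable borel" "\<And>n y. E n \<inter> f -` {y} \<notin> I"
proof -
  define inv where "inv R \<longleftrightarrow> R \<in> sets borel \<and> (\<forall>n. big I (E n - R))" for R
  have "\<exists>R. \<forall>m. inv (R m) \<and> (R m \<subseteq> R (Suc m) \<and> big I (E m \<inter> (R (Suc m) - R m)))"
  proof (rule dependent_nat_choice)
    show "\<exists>R. inv R" using bigE by (auto simp: inv_def intro!: exI[of _ "{}"])
    fix R and m :: nat
    assume R: "inv R"
    then obtain D where D: "D \<in> sets borel" "big I ((E m - R) \<inter> D)" "\<And>n. big I ((E n - R) - D)"
      using big_remove_piece[OF assms(1-3), of "\<lambda>n. E n - R" m] by (auto simp: inv_def)
    have "(E m - R) \<inter> D = E m \<inter> (R \<union> D - R)" "\<And>n. (E n - R) - D = E n - (R \<union> D)" by auto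
    with D R show "\<exists>R'. inv R' \<and> (R \<subseteq> R' \<and> big I (E m \<inter> (R' - R)))"
      by (intro exI[of _ "R \<union> D"]) (auto simp: inv_def)
  qed
  then obtain R where R: "\<And>m. inv (R m)" "\<And>m. R m \<subseteq> R (Suc m)"
    "\<And>m. big I (E m \<inter> (R (Suc m) - R m))" by blast
  have [measurable]: "R m \<in> sets borel" for m using R(1) by (simp add: inv_def)
  obtain g :: "nat \<Rightarrow> 'a \<Rightarrow> 'a" where g [measurable]: "\<And>m. g m \<in> borel_measurable borel"
    and gI: "\<And>m y. g m -` {y} \<inter> (E m \<inter> (R (Suc m) - R m)) \<notin> I"
    using R(3) unfolding big_def by metis
  \<comment> \<open>On the reserved pieces this is the stage at which \<open>x\<close> is used up.
    Its value elsewhere is harmless, since enlarging a fibre keeps it outside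
    \<open>I\<close>.\<close>
  define N where "N x = (LEAST m. x \<in> R (Suc m))" for x
  have N: "N x = m" if "x \<in> R (Suc m) - R m" for x m
    unfolding N_def
  proof (rule Least_equality)
    show "x \<in> R (Suc m)" using that by simp
    fix k assume "x \<in> R (Suc k)"
    with that lift_Suc_mono_le[of R "Suc k" m, OF R(2)] show "m \<le> k"
      by (meson DiffE in_mono not_less_eq_eq)
  qed
  have [measurable]: "N \<in> measurable borel (count_space UNIV)"
    unfolding N_def by measurable
  show thesis
  proof (rule that)
    show "(\<lambda>x. g (N x) x) \<in> borel_measurable borel"
      by (rule measurable_compose_countable[where f = g]) measurable
    fix n y
    have "g n -` {y} \<inter> (E n \<inter> (R (Suc n) - R n)) \<subseteq> E n \<inter> (\<lambda>x. g (N x) x) -` {y}"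
      using N by auto
    then show "E n \<inter> (\<lambda>x. g (N x) x) -` {y} \<notin> I"
      using gI ideal_on_subset[OF assms(1)] by metis
  qed
qed

section \<open>The four statements about the sets \<open>H_set U I n f\<close>\<close>

lemma big_if_contains_perfect:
  fixes I :: "'a::polish_space set set"
  assumes "ideal_on I" "f \<in> borel_measurable borel" "contains_perfect (H_set U I n f)" "U n \<subseteq> V"
  shows "big I V"
proof -
  obtain P where P: "P \<noteq> {}" "perfect_set P" "P \<subseteq> H_set U I n f"
    using assms(3) by (auto simp: contains_perfect_def)
  have "f -` {y} \<inter> V \<notin> I" if "y \<in> P" for y
  proof
    assume "f -` {y} \<inter> V \<in> I"
    then have "U n \<inter> f -` {y} \<in> I"
      by (rule ideal_on_subset[OF assms(1)]) (use assms(4) in auto)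
    with that P(3) show False by (auto simp: H_set_def)
  qed
  with big_if_large[OF assms(1,2) large_perfect[OF P(2,1)]] show ?thesis by blast
qed

theorem theorem6p3:
  fixes I :: "'a::polish_space set set" and U :: "nat \<Rightarrow> 'a set"
  assumes "ideal_on I"
    and "uncountable (UNIV :: 'a set)"
    and "\<forall>V. open V \<and> V \<noteq> {} \<longrightarrow> V \<notin> I"
    and "topological_basis (range U)"
    and "\<forall>n. U n \<noteq> {}"
  shows "(\<forall>x. has_M'_at I x \<longleftrightarrow>
            (\<exists>f. f \<in> borel_measurable borel \<and>
                 (\<forall>n. x \<in> U n \<longrightarrow> contains_perfect (H_set U I n f))))
    \<and> (has_M' I \<longleftrightarrow>
            (\<exists>f. f \<in> borel_measurable borel \<and> (\<forall>n. contains_perfect (H_set U I n f))))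
    \<and> (has_Mstar I \<longleftrightarrow>
            (\<exists>f. f \<in> borel_measurable borel \<and> contains_perfect (\<Inter>n. H_set U I n f)))
    \<and> (sigma_ideal_on I \<longrightarrow>
         (\<forall>f. f \<in> borel_measurable borel \<and> (\<forall>x. f -` {x} \<notin> I)
              \<and> (\<forall>n. countable (H_set U I n f) \<or> contains_perfect (H_set U I n f))
              \<longrightarrow> (\<exists>x. has_M'_at I x)))"
proof -
  note I = assms(1) and unc = assms(2)
  have openU: "open (U n)" for n using assms(4) by (auto dest: topological_basis_open)
  have nbhd: "\<exists>n. x \<in> U n \<and> U n \<subseteq> V" if "open V" "x \<in> V" for x V
    using topological_basisE[OF assms(4) that] by blast
  \<comment> \<open>An isolated point would be an open singleton, and singletons belong to
    \<open>I\<close>.\<close>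
  have perf: "perfect_set (UNIV :: 'a set)"
    unfolding perfect_set_def islimpt_UNIV_iff
    using assms(1,3) by (metis closed_UNIV empty_not_insert ideal_on_def)
  have large: "large (UNIV :: 'a set)" using large_perfect[OF perf] by simp
  have contains_UNIV: "contains_perfect S" if "\<And>y. y \<in> S" for S :: "'a set"
    using that perf by (auto simp: contains_perfect_def intro!: exI[of _ UNIV])
  have M_rel: "has_M_rel I V \<longleftrightarrow> big I V" if "open V" for V
    using that by (intro has_M_rel_iff_big) auto
  have at_if: "has_M'_at I x" if "f \<in> borel_measurable borel"
    "\<forall>n. x \<in> U n \<longrightarrow> contains_perfect (H_set U I n f)" for x f
    unfolding has_M'_at_def
  proof (intro allI impI)
    fix V assume V: "open V \<and> x \<in> V"
    then obtain n where "x \<in> U n" "U n \<subseteq> V" using nbhd by blast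
    with that V show "has_M_rel I V"
      using big_if_contains_perfect[OF I] M_rel by blast
  qed
  have 1: "has_M'_at I x \<longleftrightarrow> (\<exists>f. f \<in> borel_measurable borel \<and>
      (\<forall>n. x \<in> U n \<longrightarrow> contains_perfect (H_set U I n f)))" for x
  proof
    assume at: "has_M'_at I x"
    \<comment> \<open>The default \<open>UNIV\<close> is also a neighbourhood of \<open>x\<close>,
      so every \<open>E n\<close> is big.\<close>
    define E where "E n = (if x \<in> U n then U n else UNIV)" for n
    have E: "big I (E n)" for n
      using at openU M_rel by (auto simp: has_M'_at_def E_def)
    obtain f :: "'a \<Rightarrow> 'a" where f: "f \<in> borel_measurable borel" "\<And>n y. E n \<inter> f -` {y} \<notin> I"
      by (rule big_common_witness[OF I unc large, of E]) (rule E, blast)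
    have "contains_perfect (H_set U I n f)" if "x \<in> U n" for n
      using f(2)[of n] that by (intro contains_UNIV) (simp add: H_set_def E_def)
    with f(1) show "\<exists>f. f \<in> borel_measurable borel \<and>
      (\<forall>n. x \<in> U n \<longrightarrow> contains_perfect (H_set U I n f))" by blast
  qed (use at_if in blast)
  have 2: "has_M' I \<longleftrightarrow> (\<exists>f. f \<in> borel_measurable borel \<and> (\<forall>n. contains_perfect (H_set U I n f)))"
  proof
    assume "has_M' I"
    then have E: "big I (U n)" for n
      using openU M_rel assms(5) by (auto simp: has_M'_def)
    obtain f :: "'a \<Rightarrow> 'a" where f: "f \<in> borel_measurable borel" "\<And>n y. U n \<inter> f -` {y} \<notin> I"
      by (rule big_common_witness[OF I unc large, of U]) (rule E, blast)
    have "contains_perfect (H_set U I n f)" for n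
      using f(2) by (intro contains_UNIV) (simp add: H_set_def)
    with f(1) show "\<exists>f. f \<in> borel_measurable borel \<and> (\<forall>n. contains_perfect (H_set U I n f))"
      by blast
  next
    assume "\<exists>f. f \<in> borel_measurable borel \<and> (\<forall>n. contains_perfect (H_set U I n f))"
    \<comment> \<open>A nonempty open set is a neighbourhood of each of its points, so the converse
      direction of (1) at every point suffices.\<close>
    then have "has_M'_at I x" for x using at_if by blast
    then show "has_M' I" by (auto simp: has_M'_def has_M'_at_def)
  qed
  have 3: "has_Mstar I \<longleftrightarrow>
    (\<exists>f. f \<in> borel_measurable borel \<and> contains_perfect (\<Inter>n. H_set U I n f))"
  proof
    assume "has_Mstar I"
    then obtain f :: "'a \<Rightarrow> 'a" where f: "f \<in> borel_measurable borel"
      "\<And>y V. open V \<Longrightarrow> V \<noteq> {} \<Longrightarrow> f -` {y} \<inter> V \<notin> I" by (auto simp: has_Mstar_def)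
    have "contains_perfect (\<Inter>n. H_set U I n f)"
      using f(2)[OF openU] assms(5) by (intro contains_UNIV) (simp add: H_set_def Int_commute)
    with f(1) show "\<exists>f. f \<in> borel_measurable borel \<and> contains_perfect (\<Inter>n. H_set U I n f)" by blast
  next
    assume "\<exists>f. f \<in> borel_measurable borel \<and> contains_perfect (\<Inter>n. H_set U I n f)"
    then obtain f P where f [measurable]: "f \<in> borel_measurable borel"
      and P: "P \<noteq> {}" "perfect_set P" "P \<subseteq> (\<Inter>n. H_set U I n f)"
      by (auto simp: contains_perfect_def)
    \<comment> \<open>Since \<open>P\<close> lies in all the sets \<open>H_set U I n f\<close>, a
      single \<open>z\<close> in \<open>P\<close> above \<open>y\<close> serves all open sets at
      once.\<close>
    obtain h :: "'a \<Rightarrow> 'a" where h [measurable]: "h \<in> borel_measurable borel"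
      and hP: "\<And>y. large (h -` {y} \<inter> P)"
      using large_fibres[OF large_perfect[OF P(2,1)]] by metis
    have "(h \<circ> f) -` {y} \<inter> V \<notin> I" if V: "open V" "V \<noteq> {}" for y V
    proof
      assume fibre: "(h \<circ> f) -` {y} \<inter> V \<in> I"
      obtain z where z: "z \<in> P" "h z = y" using hP[of y] unfolding large_def by blast
      obtain n where "U n \<subseteq> V" using V nbhd by blast
      with z have "U n \<inter> f -` {z} \<in> I"
        by (intro ideal_on_subset[OF I fibre]) auto
      with z P(3) show False by (auto simp: H_set_def)
    qed
    moreover have "h \<circ> f \<in> borel_measurable borel" by measurable
    ultimately show "has_Mstar I" unfolding has_Mstar_def by blast
  qed
  have 4: "\<exists>x. has_M'_at I x" if sigma: "sigma_ideal_on I" and f: "f \<in> borel_measurable borel"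
    "\<forall>x. f -` {x} \<notin> I" "\<forall>n. countable (H_set U I n f) \<or> contains_perfect (H_set U I n f)" for f
  proof (rule ccontr)
    assume "\<nexists>x. has_M'_at I x"
    \<comment> \<open>By (1), if no point has the local property, the basic sets \<open>U n\<close>
      with countable \<open>H_set U I n f\<close> cover the space. A value \<open>y\<close> outside
      all these countable sets then has its fibre covered by countably many members of
      \<open>I\<close>.\<close>
    then have cover: "\<exists>n. x \<in> U n \<and> countable (H_set U I n f)" for x
      using at_if f by blast
    have "countable (\<Union>n\<in>{n. countable (H_set U I n f)}. H_set U I n f)"
      by (intro countable_UN) auto
    then obtain y where y: "y \<notin> (\<Union>n\<in>{n. countable (H_set U I n f)}. H_set U I n f)"
      using unc by (metis UNIV_eq_I)
    define A where "A n = (if countable (H_set U I n f) then U n \<inter> f -` {y} else {})" for n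
    have "{} \<in> I" using I by (auto simp: ideal_on_def)
    with y have "A n \<in> I" for n by (auto simp: A_def H_set_def)
    then have "(\<Union>n. A n) \<in> I" using sigma by (auto simp: sigma_ideal_on_def)
    moreover have "f -` {y} \<subseteq> (\<Union>n. A n)" using cover by (force simp: A_def)
    ultimately show False using f(2) ideal_on_subset[OF I] by blast
  qed
  show ?thesis using 1 2 3 4 by blast
qed

end
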